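(* Let $F:\mathcal{D}(F)\subseteq X\to Y$ satisfy Assumptions (A1) and (A2) of the context, and let the solution $x^\dagger\in\mathcal{D}(F)$ of $F(x)=y$ satisfy the smoothness Assumption (A3) of the context for some $0<p<1$ (so in particular $x^\dagger\notin\mathcal{D}(B)$). For all sufficiently small $\delta>0$ let $y^\delta\in Y$ satisfy $\|y-y^\delta\|_Y\le\delta$, and let $x_\alpha^\delta$ be a minimizer of the Tikhonov functional $$T_\alpha^\delta(x)=\|F(x)-y^\delta\|_Y^2+\alpha\|B(x-\bar x)\|_X^2$$ over $x\in\mathcal{D}=\mathcal{D}(F)\cap\mathcal{D}(B)$, where the regularization parameter $\alpha=\alpha_{\mathrm{DP}}(\delta,y^\delta)>0$ is chosen according to the discrepancy principle, i.e. $\|F(x_\alpha^\delta)-y^\delta\|_Y=C\delta$ with a prescribed constant $C>1$ (such a parameter is assumed to exist for all sufficiently small $\delta$). Then $$\|x_\alpha^\delta-x^\dagger\|_X=\mathcal{O}\left(\delta^{p/(a+p)}\right)\quad\text{as }\delta\to 0 .$$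
   Context: Setting. $X,Y$ are infinite-dimensional Hilbert spaces, $F:\mathcal{D}(F)\subseteq X\to Y$ is a (in general non-linear) operator, and $x^\dagger\in\mathcal{D}(F)$ is a solution of $F(x)=y$ for given $y\in Y$, so $F(x^\dagger)=y$. $B:\mathcal{D}(B)\subset X\to X$ is an unbounded self-adjoint linear operator with $\|Bx\|_X\ge m\|x\|_X$ for all $x\in\mathcal{D}(B)$ and some $m>0$ ($B$ is strictly positive). Put $\mathcal{D}:=\mathcal{D}(F)\cap\mathcal{D}(B)$; $\bar x\in\mathcal{D}$ is a fixed reference element. $B$ generates the Hilbert scale $\{X_\tau\}_{\tau\in\mathbb{R}}$ with $X_0=X$, $X_\tau=\mathcal{D}(B^\tau)$ and norms $\|x\|_\tau:=\|B^\tau x\|_X$ (so $\|x\|_{-a}=\|B^{-a}x\|_X$ for $x \in X$). Assumption (A1) (forward operator): $F$ is weakly sequentially continuous, $\mathcal{D}(F)$ is convex and closed, and $x^\dagger$ is an interior point of $\mathcal{D}(F)$. Assumption (A2) (non-linearity structure): there are $a>0$ and constants $0<c_a<C_a<\infty$ such that $c_a\|x-x^\dagger\|_{-a}\le\|F(x)-F(x^\dagger)\|_Y\le C_a\|x-x^\dagger\|_{-a}$ for all $x\in\mathcal{D}$. Assumption (A3) (solution smoothness): there are $0<p<1$ and $E<\infty$ such that $x^\dagger\in\mathcal{D}(B^p)$ and $\|B^p(x^\dagger-\bar x)\|_X\le E$, while $x^\dagger\notin\mathcal{D}(B)$. *)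

theory Defs
  imports "HOL-Analysis.Analysis" "HOL-Library.Landau_Symbols"
begin

definition infinite_dimensional :: "'a::real_vector itself \<Rightarrow> bool" where
  "infinite_dimensional _ \<longleftrightarrow> \<not> (\<exists>S::'a set. finite S \<and> span S = UNIV)"

definition weakly_tendsto :: "(nat \<Rightarrow> 'a::real_inner) \<Rightarrow> 'a \<Rightarrow> bool" where
  "weakly_tendsto u x \<longleftrightarrow> (\<forall>z. (\<lambda>n. u n \<bullet> z) \<longlonglongrightarrow> x \<bullet> z)"

definition weakly_seq_continuous_on ::
    "'a::real_inner set \<Rightarrow> ('a \<Rightarrow> 'b::real_inner) \<Rightarrow> bool" where
  "weakly_seq_continuous_on S F \<longleftrightarrow>
     (\<forall>u x. (\<forall>n. u n \<in> S) \<and> x \<in> S \<and> weakly_tendsto u x \<longrightarrow> weakly_tendsto (\<lambda>n. F (u n)) (F x))"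


text \<open>
  A (possibly unbounded) operator is a pair of a domain \<open>DB\<close> and a function \<open>B\<close>
  whose values outside \<open>DB\<close> are irrelevant.
\<close>

definition linear_op :: "'a::real_vector set \<Rightarrow> ('a \<Rightarrow> 'a) \<Rightarrow> bool" where
  "linear_op DB B \<longleftrightarrow> subspace DB \<and>
     (\<forall>x\<in>DB. \<forall>y\<in>DB. B (x + y) = B x + B y) \<and>
     (\<forall>c. \<forall>x\<in>DB. B (c *\<^sub>R x) = c *\<^sub>R B x)"

definition unbounded_op :: "'a::real_normed_vector set \<Rightarrow> ('a \<Rightarrow> 'a) \<Rightarrow> bool" where
  "unbounded_op DB B \<longleftrightarrow> \<not> (\<exists>K. \<forall>x\<in>DB. norm (B x) \<le> K * norm x)"

text \<open>The last conjunct says that the graph of the adjoint is the graph of \<open>B\<close>, domains included.\<close>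

definition self_adjoint_op :: "'a::real_inner set \<Rightarrow> ('a \<Rightarrow> 'a) \<Rightarrow> bool" where
  "self_adjoint_op DB B \<longleftrightarrow> linear_op DB B \<and> closure DB = UNIV \<and>
     (\<forall>y z. (\<forall>x\<in>DB. B x \<bullet> y = x \<bullet> z) \<longleftrightarrow> y \<in> DB \<and> z = B y)"

text \<open>
  The norm bound alone would allow negative spectrum; strict positivity also needs
  the sign condition. Together they put the spectrum into \<open>{m..}\<close>.
\<close>

definition strictly_positive_op :: "real \<Rightarrow> 'a::real_inner set \<Rightarrow> ('a \<Rightarrow> 'a) \<Rightarrow> bool" where
  "strictly_positive_op m DB B \<longleftrightarrow>
     (\<forall>x\<in>DB. x \<noteq> 0 \<longrightarrow> B x \<bullet> x > 0) \<and> (\<forall>x\<in>DB. norm (B x) \<ge> m * norm x)"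


definition orthogonal_projection :: "('a::real_inner \<Rightarrow> 'a) \<Rightarrow> bool" where
  "orthogonal_projection P \<longleftrightarrow>
     bounded_linear P \<and> (\<forall>x. P (P x) = P x) \<and> (\<forall>x y. P x \<bullet> y = x \<bullet> P y)"

definition projection_valued_measure :: "(real set \<Rightarrow> 'a::real_inner \<Rightarrow> 'a) \<Rightarrow> bool" where
  "projection_valued_measure E \<longleftrightarrow>
     (\<forall>S\<in>sets borel. orthogonal_projection (E S)) \<and>
     E UNIV = id \<and>
     (\<forall>S\<in>sets borel. \<forall>T\<in>sets borel. E (S \<inter> T) = E S \<circ> E T) \<and>
     (\<forall>A x. range A \<subseteq> sets borel \<and> disjoint_family A \<longrightarrow>
        (\<lambda>n::nat. E (A n) x) sums E (\<Union>n. A n) x)"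

definition scalar_spectral_measure ::
    "(real set \<Rightarrow> 'a::real_inner \<Rightarrow> 'a) \<Rightarrow> 'a \<Rightarrow> real measure" where
  "scalar_spectral_measure E x = measure_of UNIV (sets borel) (\<lambda>S. ennreal (E S x \<bullet> x))"

definition simple_spectral_integral ::
    "(real set \<Rightarrow> 'a::real_inner \<Rightarrow> 'a) \<Rightarrow> (real \<Rightarrow> real) \<Rightarrow> 'a \<Rightarrow> 'a" where
  "simple_spectral_integral E s x = (\<Sum>c\<in>range s. c *\<^sub>R E (s -` {c}) x)"

text \<open>
  The graph of the operator \<open>\<integral>f dE\<close>. For fixed \<open>x\<close>, the map
  \<open>s \<mapsto> simple_spectral_integral E s x\<close> is an isometry from the simple functions in
  \<open>L\<^sup>2(scalar_spectral_measure E x)\<close>, so the limit \<open>y\<close> exists for every \<open>x\<close>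
  in the usual domain (those \<open>x\<close> with \<open>f \<in> L\<^sup>2(scalar_spectral_measure E x)\<close>),
  and it does not depend on the approximating sequence.
\<close>

definition spectral_integral ::
    "(real set \<Rightarrow> 'a::real_inner \<Rightarrow> 'a) \<Rightarrow> (real \<Rightarrow> real) \<Rightarrow> ('a \<times> 'a) set" where
  "spectral_integral E f = {(x, y).
     (\<integral>\<^sup>+ t. ennreal ((f t)\<^sup>2) \<partial>scalar_spectral_measure E x) < \<infinity> \<and>
     (\<exists>s. (\<forall>n. simple_function borel (s n)) \<and>
        (\<lambda>n. \<integral>\<^sup>+ t. ennreal ((s n t - f t)\<^sup>2) \<partial>scalar_spectral_measure E x) \<longlonglongrightarrow> 0 \<and>
        (\<lambda>n. simple_spectral_integral E (s n) x) \<longlonglongrightarrow> y)}"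

definition is_spectral_measure_of ::
    "(real set \<Rightarrow> 'a::real_inner \<Rightarrow> 'a) \<Rightarrow> 'a set \<Rightarrow> ('a \<Rightarrow> 'a) \<Rightarrow> bool" where
  "is_spectral_measure_of E DB B \<longleftrightarrow>
     projection_valued_measure E \<and> {(x, B x) | x. x \<in> DB} = spectral_integral E (\<lambda>t. t)"

text \<open>
  By the spectral theorem a self-adjoint operator has a spectral measure, unique on
  Borel sets. The values of \<open>E\<close> on other sets are unconstrained, hence \<open>SOME\<close>
  and not \<open>THE\<close>.
\<close>

definition spectral_measure_of ::
    "'a::real_inner set \<Rightarrow> ('a \<Rightarrow> 'a) \<Rightarrow> real set \<Rightarrow> 'a \<Rightarrow> 'a" where
  "spectral_measure_of DB B = (SOME E. is_spectral_measure_of E DB B)"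

text \<open>
  \<open>B\<^sup>\<tau> = \<integral>t\<^sup>\<tau> dE(t)\<close> as a graph, for positive \<open>B\<close>. The first conjunct holds for
  every self-adjoint \<open>B\<close>; it leaves the power undefined if \<open>B\<close> has no spectral measure.
\<close>

definition op_powr_graph ::
    "'a::real_inner set \<Rightarrow> ('a \<Rightarrow> 'a) \<Rightarrow> real \<Rightarrow> ('a \<times> 'a) set" where
  "op_powr_graph DB B \<tau> = {(x, y).
     is_spectral_measure_of (spectral_measure_of DB B) DB B \<and>
     (x, y) \<in> spectral_integral (spectral_measure_of DB B) (\<lambda>t. t powr \<tau>)}"

definition op_powr_dom :: "'a::real_inner set \<Rightarrow> ('a \<Rightarrow> 'a) \<Rightarrow> real \<Rightarrow> 'a set" where
  "op_powr_dom DB B \<tau> = Domain (op_powr_graph DB B \<tau>)"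

definition op_powr :: "'a::real_inner set \<Rightarrow> ('a \<Rightarrow> 'a) \<Rightarrow> real \<Rightarrow> 'a \<Rightarrow> 'a" where
  "op_powr DB B \<tau> x = (THE y. (x, y) \<in> op_powr_graph DB B \<tau>)"

definition scale_norm :: "'a::real_inner set \<Rightarrow> ('a \<Rightarrow> 'a) \<Rightarrow> real \<Rightarrow> 'a \<Rightarrow> real" where
  "scale_norm DB B \<tau> x = norm (op_powr DB B \<tau> x)"


definition tikhonov ::
    "('a::real_normed_vector \<Rightarrow> 'b::real_normed_vector) \<Rightarrow> ('a \<Rightarrow> 'a) \<Rightarrow> 'a \<Rightarrow> 'b \<Rightarrow> real \<Rightarrow> 'a \<Rightarrow> real"
  where
  "tikhonov F B xbar yd \<alpha> x = (norm (F x - yd))\<^sup>2 + \<alpha> * (norm (B (x - xbar)))\<^sup>2"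

end

theory Submission imports Defs begin

text \<open>
  The penalty \<open>norm (B (x - xbar))\<close> is infinite at the solution \<open>xdag\<close>, so minimality of
  the Tikhonov functional cannot be tested at \<open>xdag\<close> itself. It is tested at a smooth competitor:
  the spectral cutoff \<open>xk = E {..k} xdag\<close>, where \<open>E\<close> is the spectral measure of \<open>B\<close>.
  If \<open>xdag\<close> lies in the domain of \<open>B\<^sup>p\<close>, then \<open>xk - xdag\<close> has norm of order
  \<open>k powr - p\<close> and weak norm (the norm with index \<open>- a\<close>) of order \<open>k powr (- a - p)\<close>, whereas
  \<open>norm (B xk)\<close> grows only like \<open>k powr (1 - p)\<close>. For large \<open>k\<close> the competitor lies in the
  domain of \<open>F\<close>, because \<open>xdag\<close> is an interior point.

  The cutoff \<open>k\<close> is chosen of order \<open>\<delta> powr (- 1 / (a + p))\<close>, with a constant such that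
  the misfit of the competitor is at most \<open>(C - 1) * \<delta> + \<delta> = C * \<delta>\<close>. This is exactly the misfit
  that the discrepancy principle prescribes for the minimizer. Hence the misfit terms drop out of
  the minimality inequality, the positive parameter \<open>\<alpha>\<close> cancels, and the penalty of the minimizer is
  at most that of the competitor, whatever the size of \<open>\<alpha>\<close>.

  The minimizer thus has strong norm of order \<open>k powr (1 - p)\<close>, and the lower bound of the
  nonlinearity condition gives it weak distance of order \<open>\<delta>\<close>, that is \<open>k powr (- a - p)\<close>, from
  \<open>xdag\<close>. Cutting the error at the same frequency \<open>k\<close> interpolates between the two
  (\<open>error_splitting\<close>): low frequencies lose a factor \<open>k powr a\<close> against the weak norm, high
  frequencies gain a factor \<open>1 / k\<close> against the strong norm, and both parts are of order
  \<open>k powr - p\<close>, which is \<open>\<delta> powr (p / (a + p))\<close>.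

  The frequency estimates follow from functional calculus for a projection-valued measure: the
  isometry of the spectral integral reduces them to pointwise comparisons of powers on the spectrum
  (\<open>spectral_integral_dominated\<close>), and strict positivity confines the spectrum to values above a
  positive number (\<open>AE_spectrum_gt\<close>).
\<close>

section \<open>Projection-valued measures\<close>

locale pvm =
  fixes E :: "real set \<Rightarrow> 'a::{real_inner, complete_space} \<Rightarrow> 'a"
  assumes pvm: "projection_valued_measure E"
begin

lemma projection: "S \<in> sets borel \<Longrightarrow> orthogonal_projection (E S)"
  using pvm by (simp add: projection_valued_measure_def)

lemma bounded_linear_E: "S \<in> sets borel \<Longrightarrow> bounded_linear (E S)"
  using projection by (auto simp: orthogonal_projection_def)

lemma E_UNIV [simp]: "E UNIV x = x"
  using pvm by (simp add: projection_valued_measure_def)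

lemma E_Int: "S \<in> sets borel \<Longrightarrow> T \<in> sets borel \<Longrightarrow> E S (E T x) = E (S \<inter> T) x"
  using pvm by (simp add: projection_valued_measure_def)

lemma E_sums:
  fixes A :: "nat \<Rightarrow> real set"
  assumes "range A \<subseteq> sets borel" "disjoint_family A"
  shows "(\<lambda>n. E (A n) x) sums E (\<Union>n. A n) x"
  using pvm assms by (simp add: projection_valued_measure_def)

lemma E_selfadjoint: "S \<in> sets borel \<Longrightarrow> E S x \<bullet> y = x \<bullet> E S y"
  using projection by (auto simp: orthogonal_projection_def)

lemma E_idem: "S \<in> sets borel \<Longrightarrow> E S (E S x) = E S x"
  by (simp add: E_Int)

lemma E_inner_self: "S \<in> sets borel \<Longrightarrow> E S x \<bullet> x = (norm (E S x))\<^sup>2"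
  by (metis E_idem E_selfadjoint inner_commute power2_norm_eq_inner)

lemma norm_E_le: "S \<in> sets borel \<Longrightarrow> norm (E S x) \<le> norm x"
proof -
  assume S: "S \<in> sets borel"
  have "norm (E S x) * norm (E S x) \<le> norm (E S x) * norm x"
    using E_inner_self[OF S, of x] norm_cauchy_schwarz[of "E S x" x]
    by (simp add: power2_eq_square)
  then show ?thesis
    by (metis mult_le_cancel_left_pos norm_ge_zero order_le_less)
qed

text \<open>A convergent series with constant terms \<open>E {} x\<close> forces these terms to vanish.\<close>

lemma E_empty [simp]: "E {} x = 0"
proof -
  have "(\<lambda>n::nat. E {} x) sums E {} x"
    using E_sums[of "\<lambda>_. {}" x] by (simp add: disjoint_family_on_def)
  then have "(\<lambda>n::nat. E {} x) \<longlonglongrightarrow> 0"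
    using summable_LIMSEQ_zero sums_summable by blast
  then show ?thesis by (simp add: LIMSEQ_const_iff)
qed

lemma E_Un:
  assumes "S \<in> sets borel" "T \<in> sets borel" "S \<inter> T = {}"
  shows "E (S \<union> T) x = E S x + E T x"
proof -
  have r: "range (binaryset S T) \<subseteq> sets borel" "disjoint_family (binaryset S T)"
    using assms by (auto simp: binaryset_def disjoint_family_on_def)
  have "(\<lambda>n. E (binaryset S T n) x) sums E (\<Union>n. binaryset S T n) x"
    by (rule E_sums[OF r])
  moreover have "(\<lambda>n. E (binaryset S T n) x) sums (E S x + E T x)"
    by (rule binaryset_sums[where f = "\<lambda>S. E S x"]) simp
  ultimately show ?thesis
    using sums_unique2 by (metis UN_binaryset_eq)
qed

lemma E_UN_finite:
  assumes "finite I" "\<And>i. i \<in> I \<Longrightarrow> A i \<in> sets borel" "disjoint_family_on A I"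
  shows "E (\<Union>i\<in>I. A i) x = (\<Sum>i\<in>I. E (A i) x)"
  using assms
proof (induction I rule: finite_induct)
  case (insert i I)
  have "E (A i \<union> (\<Union>j\<in>I. A j)) x = E (A i) x + E (\<Union>j\<in>I. A j) x"
  proof (rule E_Un)
    show "(\<Union>j\<in>I. A j) \<in> sets borel" using insert by auto
    show "A i \<inter> (\<Union>j\<in>I. A j) = {}"
      using insert by (fastforce simp: disjoint_family_on_def)
  qed (use insert in auto)
  then show ?case
    using insert by (auto simp: disjoint_family_on_def)
qed simp

lemma E_split: "S \<in> sets borel \<Longrightarrow> x = E S x + E (- S) x"
  using E_Un[of S "- S" x] by simp

lemma E_diff: "S \<in> sets borel \<Longrightarrow> E S (x - y) = E S x - E S y"
  using bounded_linear_E by (simp add: bounded_linear.linear linear_diff)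

section \<open>Scalar spectral measures\<close>

abbreviation \<mu> :: "'a \<Rightarrow> real measure" where
  "\<mu> x \<equiv> scalar_spectral_measure E x"

lemma space_\<mu> [simp]: "space (\<mu> x) = UNIV"
  and sets_\<mu> [simp, measurable_cong]: "sets (\<mu> x) = sets borel"
  using sets.sigma_sets_eq[of "borel :: real measure"]
  by (simp_all add: scalar_spectral_measure_def)

lemma emeasure_\<mu>:
  assumes "S \<in> sets borel"
  shows "emeasure (\<mu> x) S = ennreal ((norm (E S x))\<^sup>2)"
proof -
  have "countably_additive (sets borel) (\<lambda>S. ennreal (E S x \<bullet> x))"
  proof (rule countably_additiveI)
    fix A :: "nat \<Rightarrow> real set"
    assume A: "range A \<subseteq> sets borel" "disjoint_family A" "\<Union> (range A) \<in> sets borel"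
    have "(\<lambda>n. E (A n) x \<bullet> x) sums (E (\<Union>n. A n) x \<bullet> x)"
      by (rule bounded_linear.sums[OF bounded_linear_inner_left E_sums[OF A(1,2)]])
    moreover have "0 \<le> E (A n) x \<bullet> x" for n
      using A(1) E_inner_self[of "A n" x] by auto
    ultimately show "(\<Sum>n. ennreal (E (A n) x \<bullet> x)) = ennreal (E (\<Union> (range A)) x \<bullet> x)"
      by (intro suminf_ennreal_eq) auto
  qed
  moreover have "positive (sets borel) (\<lambda>S. ennreal (E S x \<bullet> x))"
    by (simp add: positive_def)
  ultimately have "emeasure (\<mu> x) S = ennreal (E S x \<bullet> x)"
    unfolding scalar_spectral_measure_def
    by (intro emeasure_measure_of_sigma)
      (use assms sets.sigma_algebra_axioms[of "borel::real measure"] in auto)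
  then show ?thesis by (simp add: E_inner_self assms)
qed

lemma measurable_\<mu> [simp]: "borel_measurable (\<mu> x) = borel_measurable borel"
  by (rule measurable_cong_sets) auto

lemma \<mu>_E:
  assumes S: "S \<in> sets borel"
  shows "\<mu> (E S x) = density (\<mu> x) (indicator S)"
proof (rule measure_eqI)
  fix T assume "T \<in> sets (\<mu> (E S x))"
  then have T: "T \<in> sets borel" by simp
  have "emeasure (density (\<mu> x) (indicator S)) T = (\<integral>\<^sup>+ t. indicator S t * indicator T t \<partial>\<mu> x)"
    using S T by (subst emeasure_density) auto
  also have "\<dots> = (\<integral>\<^sup>+ t. indicator (S \<inter> T) t \<partial>\<mu> x)"
    by (simp only: indicator_inter_arith)
  also have "\<dots> = ennreal ((norm (E (S \<inter> T) x))\<^sup>2)"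
    using S T emeasure_\<mu>[of "S \<inter> T" x] by (subst nn_integral_indicator) auto
  finally show "emeasure (\<mu> (E S x)) T = emeasure (density (\<mu> x) (indicator S)) T"
    using S T by (simp add: emeasure_\<mu> E_Int Int_commute)
qed simp

lemma AE_\<mu>_E:
  assumes "S \<in> sets borel" "AE t in \<mu> x. t \<in> S \<longrightarrow> P t"
  shows "AE t in \<mu> (E S x). P t"
  unfolding \<mu>_E[OF assms(1)] using assms by (subst AE_density) (auto elim!: eventually_mono)

lemma nn_integral_\<mu>_E_le:
  assumes "S \<in> sets borel" "f \<in> borel_measurable borel"
  shows "(\<integral>\<^sup>+ t. f t \<partial>\<mu> (E S x)) \<le> (\<integral>\<^sup>+ t. f t \<partial>\<mu> x)"
  using assms by (simp add: \<mu>_E nn_integral_density) (auto intro!: nn_integral_mono simp: indicator_def)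

lemma AE_notin_if_E_eq_0:
  assumes "S \<in> sets borel" "E S x = 0"
  shows "AE t in \<mu> x. t \<notin> S"
  using assms emeasure_\<mu>[OF assms(1), of x] by (intro AE_not_in) (auto simp: null_sets_def)

section \<open>The spectral integral of a measurable function\<close>

text \<open>
  Two simple functions are compared on a common refinement, so the integral of a simple
  function must be computable from any finite partition on whose cells it is constant.
\<close>

lemma simple_spectral_integral_refine:
  assumes g: "finite (range g)" "\<And>v. g -` {v} \<in> sets borel"
  shows "simple_spectral_integral E (\<lambda>t. h (g t)) x = (\<Sum>v\<in>range g. h v *\<^sub>R E (g -` {v}) x)"
proof -
  have cell: "c *\<^sub>R E ((\<lambda>t. h (g t)) -` {c}) x =
      (\<Sum>v\<in>{v \<in> range g. h v = c}. h v *\<^sub>R E (g -` {v}) x)" for c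
  proof -
    have "(\<lambda>t. h (g t)) -` {c} = (\<Union>v\<in>{v \<in> range g. h v = c}. g -` {v})"
      by auto
    moreover have "E (\<Union>v\<in>{v \<in> range g. h v = c}. g -` {v}) x =
        (\<Sum>v\<in>{v \<in> range g. h v = c}. E (g -` {v}) x)"
      using g by (intro E_UN_finite) (auto simp: disjoint_family_on_def)
    ultimately show ?thesis
      by (simp add: scaleR_sum_right)
  qed
  have "simple_spectral_integral E (\<lambda>t. h (g t)) x =
      (\<Sum>c\<in>h ` range g. \<Sum>v\<in>{v \<in> range g. h v = c}. h v *\<^sub>R E (g -` {v}) x)"
    unfolding simple_spectral_integral_def cell by (simp add: image_image)
  also have "\<dots> = (\<Sum>v\<in>range g. h v *\<^sub>R E (g -` {v}) x)"
    using g by (intro sum.group) auto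
  finally show ?thesis .
qed

text \<open>Projections onto disjoint sets have orthogonal ranges, so Pythagoras applies cell by cell.\<close>

lemma norm_sum_scaleR_E:
  fixes g :: "real \<Rightarrow> 'c"
  assumes g: "finite (range g)" "\<And>v. g -` {v} \<in> sets borel"
  shows "ennreal ((norm (\<Sum>v\<in>range g. h v *\<^sub>R E (g -` {v}) x))\<^sup>2) =
    (\<integral>\<^sup>+ t. ennreal ((h (g t))\<^sup>2) \<partial>\<mu> x)"
proof -
  have orth: "pairwise (\<lambda>v w. orthogonal (h v *\<^sub>R E (g -` {v}) x) (h w *\<^sub>R E (g -` {w}) x)) (range g)"
  proof (rule pairwiseI)
    fix v w :: 'c assume "v \<noteq> w"
    then have "g -` {v} \<inter> g -` {w} = {}" by auto
    then have "E (g -` {v}) x \<bullet> E (g -` {w}) x = 0"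
      using g by (simp add: E_selfadjoint E_Int)
    then show "orthogonal (h v *\<^sub>R E (g -` {v}) x) (h w *\<^sub>R E (g -` {w}) x)"
      by (simp add: orthogonal_def)
  qed
  have pw: "ennreal ((h (g t))\<^sup>2) = (\<Sum>v\<in>range g. ennreal ((h v)\<^sup>2) * indicator (g -` {v}) t)" for t
  proof -
    have "(\<Sum>v\<in>range g. ennreal ((h v)\<^sup>2) * indicator (g -` {v}) t) =
        (\<Sum>v\<in>range g. if g t = v then ennreal ((h v)\<^sup>2) else 0)"
      by (intro sum.cong) auto
    then show ?thesis using g by simp
  qed
  have "(\<integral>\<^sup>+ t. ennreal ((h (g t))\<^sup>2) \<partial>\<mu> x) =
      (\<Sum>v\<in>range g. ennreal ((h v)\<^sup>2) * ennreal ((norm (E (g -` {v}) x))\<^sup>2))"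
    unfolding pw using g
    by (subst nn_integral_sum) (auto simp: nn_integral_cmult_indicator emeasure_\<mu>)
  also have "\<dots> = ennreal (\<Sum>v\<in>range g. (norm (h v *\<^sub>R E (g -` {v}) x))\<^sup>2)"
    by (subst sum_ennreal[symmetric]) (auto simp: power_mult_distrib ennreal_mult)
  also have "\<dots> = ennreal ((norm (\<Sum>v\<in>range g. h v *\<^sub>R E (g -` {v}) x))\<^sup>2)"
    by (subst norm_sum_Pythagorean[OF g(1) orth]) simp
  finally show ?thesis by simp
qed

lemma simple_spectral_integral_isometry:
  assumes s: "simple_function borel s" and t: "simple_function borel t"
  shows "ennreal ((norm (simple_spectral_integral E s x - simple_spectral_integral E t x))\<^sup>2) =
    (\<integral>\<^sup>+ r. ennreal ((s r - t r)\<^sup>2) \<partial>\<mu> x)"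
proof -
  define g where "g = (\<lambda>r. (s r, t r))"
  have "range g \<subseteq> range s \<times> range t" by (auto simp: g_def)
  moreover have "finite (range s)" "finite (range t)"
    using simple_functionD(1)[OF s] simple_functionD(1)[OF t] by auto
  ultimately have fin: "finite (range g)"
    by (meson finite_SigmaI finite_subset)
  have "g -` {(c, d)} = s -` {c} \<inter> t -` {d}" for c d by (auto simp: g_def)
  moreover have "s -` {c} \<in> sets borel" "t -` {d} \<in> sets borel" for c d
    using simple_functionD(2)[OF s, of "{c}"] simple_functionD(2)[OF t, of "{d}"] by auto
  ultimately have meas: "g -` {v} \<in> sets borel" for v
    by (metis prod.collapse sets.Int)
  note refine = simple_spectral_integral_refine[where g = g and x = x, OF fin meas]
  have "simple_spectral_integral E s x - simple_spectral_integral E t x =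
      (\<Sum>v\<in>range g. fst v *\<^sub>R E (g -` {v}) x) - (\<Sum>v\<in>range g. snd v *\<^sub>R E (g -` {v}) x)"
    using refine[of fst] refine[of snd] by (simp add: g_def)
  also have "\<dots> = (\<Sum>v\<in>range g. (fst v - snd v) *\<^sub>R E (g -` {v}) x)"
    by (simp add: sum_subtractf scaleR_diff_left)
  finally show ?thesis
    using norm_sum_scaleR_E[where g = g and h = "\<lambda>v. fst v - snd v" and x = x, OF fin meas]
    by (simp add: g_def)
qed

lemma norm_simple_spectral_integral:
  assumes "simple_function borel s"
  shows "ennreal ((norm (simple_spectral_integral E s x))\<^sup>2) = (\<integral>\<^sup>+ r. ennreal ((s r)\<^sup>2) \<partial>\<mu> x)"
  using simple_spectral_integral_isometry[OF assms simple_function_const[of borel 0], of x]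
  by (simp add: simple_spectral_integral_def)

definition L2_approx :: "'a \<Rightarrow> (real \<Rightarrow> real) \<Rightarrow> (nat \<Rightarrow> real \<Rightarrow> real) \<Rightarrow> bool" where
  "L2_approx x f s \<longleftrightarrow> (\<forall>n. simple_function borel (s n)) \<and>
     (\<lambda>n. \<integral>\<^sup>+ t. ennreal ((s n t - f t)\<^sup>2) \<partial>\<mu> x) \<longlonglongrightarrow> 0"

lemma spectral_integral_iff:
  "(x, y) \<in> spectral_integral E f \<longleftrightarrow>
    (\<integral>\<^sup>+ t. ennreal ((f t)\<^sup>2) \<partial>\<mu> x) < \<infinity> \<and>
    (\<exists>s. L2_approx x f s \<and> (\<lambda>n. simple_spectral_integral E (s n) x) \<longlonglongrightarrow> y)"
  unfolding spectral_integral_def L2_approx_def mem_Collect_eq prod.case conj_assoc ..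

lemma nn_integral_diff_square_le:
  assumes [measurable]: "f \<in> borel_measurable borel" "s \<in> borel_measurable borel" "u \<in> borel_measurable borel"
  shows "(\<integral>\<^sup>+ t. ennreal ((s t - u t)\<^sup>2) \<partial>\<mu> x) \<le>
    2 * (\<integral>\<^sup>+ t. ennreal ((s t - f t)\<^sup>2) \<partial>\<mu> x) + 2 * (\<integral>\<^sup>+ t. ennreal ((u t - f t)\<^sup>2) \<partial>\<mu> x)"
proof -
  have "(a - b)\<^sup>2 \<le> 2 * (a - c)\<^sup>2 + 2 * (b - c)\<^sup>2" for a b c :: real
    using zero_le_power2[of "a + b - 2 * c"] by (simp add: power2_eq_square algebra_simps)
  then have "ennreal ((a - b)\<^sup>2) \<le> ennreal (2 * (a - c)\<^sup>2 + 2 * (b - c)\<^sup>2)" for a b c :: real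
    by (rule ennreal_leI)
  then have "ennreal ((a - b)\<^sup>2) \<le> 2 * ennreal ((a - c)\<^sup>2) + 2 * ennreal ((b - c)\<^sup>2)" for a b c :: real
    by (simp add: ennreal_mult')
  then have "(\<integral>\<^sup>+ t. ennreal ((s t - u t)\<^sup>2) \<partial>\<mu> x) \<le>
      (\<integral>\<^sup>+ t. 2 * ennreal ((s t - f t)\<^sup>2) + 2 * ennreal ((u t - f t)\<^sup>2) \<partial>\<mu> x)"
    by (intro nn_integral_mono)
  also have "\<dots> = 2 * (\<integral>\<^sup>+ t. ennreal ((s t - f t)\<^sup>2) \<partial>\<mu> x) + 2 * (\<integral>\<^sup>+ t. ennreal ((u t - f t)\<^sup>2) \<partial>\<mu> x)"
    by (simp add: nn_integral_add nn_integral_cmult)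
  finally show ?thesis .
qed

lemma norm_simple_spectral_integral_diff_le:
  assumes "f \<in> borel_measurable borel" "simple_function borel s" "simple_function borel u"
  shows "ennreal ((norm (simple_spectral_integral E s x - simple_spectral_integral E u x))\<^sup>2) \<le>
    2 * (\<integral>\<^sup>+ t. ennreal ((s t - f t)\<^sup>2) \<partial>\<mu> x) + 2 * (\<integral>\<^sup>+ t. ennreal ((u t - f t)\<^sup>2) \<partial>\<mu> x)"
  unfolding simple_spectral_integral_isometry[OF assms(2,3)]
  by (rule nn_integral_diff_square_le[OF assms(1) assms(2,3)[THEN borel_measurable_simple_function]])

lemma L2_approx_simple: "L2_approx x f s \<Longrightarrow> simple_function borel (s n)"
  unfolding L2_approx_def by blast

lemma L2_approx_tendsto:
  "L2_approx x f s \<Longrightarrow> (\<lambda>n. \<integral>\<^sup>+ t. ennreal ((s n t - f t)\<^sup>2) \<partial>\<mu> x) \<longlonglongrightarrow> 0"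
  unfolding L2_approx_def by blast

text \<open>
  By the isometry the limit does not depend on the approximating sequence. This gives uniqueness
  of the integral and allows the sequence to be chosen to suit each argument below.
\<close>

lemma L2_approx_LIMSEQ:
  assumes f: "f \<in> borel_measurable borel" and xy: "(x, y) \<in> spectral_integral E f"
    and u: "L2_approx x f u"
  shows "(\<lambda>n. simple_spectral_integral E (u n) x) \<longlonglongrightarrow> y"
proof -
  obtain s where s: "L2_approx x f s" "(\<lambda>n. simple_spectral_integral E (s n) x) \<longlonglongrightarrow> y"
    using xy unfolding spectral_integral_iff by blast
  define d where "d n = simple_spectral_integral E (u n) x - simple_spectral_integral E (s n) x" for n
  define e where "e n = 2 * (\<integral>\<^sup>+ t. ennreal ((u n t - f t)\<^sup>2) \<partial>\<mu> x) +
    2 * (\<integral>\<^sup>+ t. ennreal ((s n t - f t)\<^sup>2) \<partial>\<mu> x)" for n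
  have "e \<longlonglongrightarrow> 2 * 0 + 2 * 0"
    unfolding e_def
    by (intro tendsto_add ennreal_tendsto_cmult L2_approx_tendsto u s(1)) simp_all
  then have e: "e \<longlonglongrightarrow> 0" by simp
  have le: "ennreal ((norm (d n))\<^sup>2) \<le> e n" for n
    unfolding d_def e_def
    by (rule norm_simple_spectral_integral_diff_le[OF f L2_approx_simple[OF u] L2_approx_simple[OF s(1)]])
  have "(\<lambda>n. ennreal ((norm (d n))\<^sup>2)) \<longlonglongrightarrow> ennreal 0"
    unfolding ennreal_0
    by (rule tendsto_sandwich[OF _ _ tendsto_const e]) (use le in \<open>simp_all add: always_eventually\<close>)
  then have "(\<lambda>n. (norm (d n))\<^sup>2) \<longlonglongrightarrow> 0"
    by (subst (asm) tendsto_ennreal_iff) simp_all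
  then have "d \<longlonglongrightarrow> 0"
    by (simp add: power_tendsto_0_iff tendsto_norm_zero_iff)
  from tendsto_add[OF this s(2)] show ?thesis by (simp add: d_def)
qed

text \<open>
  A pointwise approximation dominated by \<open>2 * \<bar>f\<bar>\<close> converges in \<open>L\<^sup>2\<close>; the convergence of
  the square integrals serves to compute the norm of the limit.
\<close>

lemma L2_approx_exists:
  assumes f[measurable]: "f \<in> borel_measurable borel"
    and fin: "(\<integral>\<^sup>+ t. ennreal ((f t)\<^sup>2) \<partial>\<mu> x) < \<infinity>"
  obtains s where "L2_approx x f s"
    "(\<lambda>n. \<integral>\<^sup>+ t. ennreal ((s n t)\<^sup>2) \<partial>\<mu> x) \<longlonglongrightarrow> (\<integral>\<^sup>+ t. ennreal ((f t)\<^sup>2) \<partial>\<mu> x)"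
proof -
  obtain s where s: "\<And>n. simple_function borel (s n)" "\<And>t. (\<lambda>n. s n t) \<longlonglongrightarrow> f t"
      "\<And>n t. \<bar>s n t\<bar> \<le> 2 * \<bar>f t\<bar>"
    using borel_measurable_implies_sequence_metric[OF f, of 0] by auto
  have [measurable]: "s n \<in> borel_measurable borel" for n
    using s(1) by (rule borel_measurable_simple_function)
  have fin9: "(\<integral>\<^sup>+ t. ennreal (9 * (f t)\<^sup>2) \<partial>\<mu> x) < \<infinity>"
    using fin by (simp add: ennreal_mult nn_integral_cmult ennreal_mult_less_top)
  have bound: "(s n t)\<^sup>2 \<le> 9 * (f t)\<^sup>2" "(s n t - f t)\<^sup>2 \<le> 9 * (f t)\<^sup>2" for n t
  proof -
    have "\<bar>s n t\<bar> \<le> \<bar>3 * f t\<bar>" "\<bar>s n t - f t\<bar> \<le> \<bar>3 * f t\<bar>"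
      using s(3)[of n t] by linarith+
    then show "(s n t)\<^sup>2 \<le> 9 * (f t)\<^sup>2" "(s n t - f t)\<^sup>2 \<le> 9 * (f t)\<^sup>2"
      by (auto simp: abs_le_square_iff power_mult_distrib)
  qed
  have "(\<lambda>n. \<integral>\<^sup>+ t. ennreal ((s n t)\<^sup>2) \<partial>\<mu> x) \<longlonglongrightarrow> (\<integral>\<^sup>+ t. ennreal ((f t)\<^sup>2) \<partial>\<mu> x)"
    by (rule nn_integral_dominated_convergence[where w = "\<lambda>t. ennreal (9 * (f t)\<^sup>2)"])
      (auto simp: fin9[simplified] bound intro!: tendsto_intros s(2) ennreal_leI)
  moreover have "(\<lambda>n. ennreal ((s n t - f t)\<^sup>2)) \<longlonglongrightarrow> ennreal ((f t - f t)\<^sup>2)" for t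
    by (intro tendsto_intros s(2))
  then have "(\<lambda>n. \<integral>\<^sup>+ t. ennreal ((s n t - f t)\<^sup>2) \<partial>\<mu> x) \<longlonglongrightarrow> (\<integral>\<^sup>+ t. ennreal 0 \<partial>\<mu> x)"
    by (intro nn_integral_dominated_convergence[where w = "\<lambda>t. ennreal (9 * (f t)\<^sup>2)"])
      (auto simp: fin9[simplified] bound intro!: ennreal_leI)
  ultimately show ?thesis
    using that[of s] s(1) by (simp add: L2_approx_def)
qed

text \<open>
  The isometry turns an \<open>L\<^sup>2\<close>-approximating sequence into a Cauchy sequence in the
  complete space, so square integrability is the only condition for membership in the domain.
\<close>

lemma spectral_integral_exists:
  assumes f: "f \<in> borel_measurable borel"
    and fin: "(\<integral>\<^sup>+ t. ennreal ((f t)\<^sup>2) \<partial>\<mu> x) < \<infinity>"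
  shows "\<exists>y. (x, y) \<in> spectral_integral E f"
proof -
  obtain s where s: "L2_approx x f s"
    using L2_approx_exists[OF assms] by blast
  let ?I = "\<lambda>n. simple_spectral_integral E (s n) x"
  let ?e = "\<lambda>n. \<integral>\<^sup>+ t. ennreal ((s n t - f t)\<^sup>2) \<partial>\<mu> x"
  have "Cauchy ?I"
  proof (rule CauchyI)
    fix \<epsilon> :: real assume \<epsilon>: "0 < \<epsilon>"
    have "eventually (\<lambda>n. ?e n < ennreal (\<epsilon>\<^sup>2 / 4)) sequentially"
      using \<epsilon> by (intro order_tendstoD(2)[OF L2_approx_tendsto[OF s]]) simp
    then obtain N where N: "\<And>n. n \<ge> N \<Longrightarrow> ?e n < ennreal (\<epsilon>\<^sup>2 / 4)"
      by (auto simp: eventually_sequentially)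
    have "norm (?I j - ?I k) < \<epsilon>" if "j \<ge> N" "k \<ge> N" for j k
    proof -
      have "ennreal ((norm (?I j - ?I k))\<^sup>2) \<le> 2 * ?e j + 2 * ?e k"
        by (rule norm_simple_spectral_integral_diff_le[OF f L2_approx_simple[OF s] L2_approx_simple[OF s]])
      also have "\<dots> < 2 * ennreal (\<epsilon>\<^sup>2 / 4) + 2 * ennreal (\<epsilon>\<^sup>2 / 4)"
        using N[OF that(1)] N[OF that(2)]
        by (intro add_strict_mono ennreal_mult_strict_left_mono) auto
      also have "\<dots> = ennreal (\<epsilon>\<^sup>2)"
        by (simp flip: ennreal_numeral ennreal_mult ennreal_plus)
      finally have "(norm (?I j - ?I k))\<^sup>2 < \<epsilon>\<^sup>2"
        using \<epsilon> by (simp add: ennreal_less_iff)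
      then show ?thesis using \<epsilon> by (meson power_less_imp_less_base less_imp_le)
    qed
    then show "\<exists>M. \<forall>m\<ge>M. \<forall>n\<ge>M. norm (?I m - ?I n) < \<epsilon>" by blast
  qed
  then obtain y where "?I \<longlonglongrightarrow> y"
    using Cauchy_convergent convergent_def by blast
  then show ?thesis using fin s by (auto simp: spectral_integral_iff)
qed

lemma spectral_integral_unique:
  assumes f: "f \<in> borel_measurable borel"
    and y: "(x, y) \<in> spectral_integral E f" and z: "(x, z) \<in> spectral_integral E f"
  shows "y = z"
proof -
  obtain s where "L2_approx x f s"
    using y unfolding spectral_integral_iff by blast
  then show ?thesis
    using L2_approx_LIMSEQ[OF f y] L2_approx_LIMSEQ[OF f z] LIMSEQ_unique by blast
qed

lemma norm_spectral_integral:
  assumes f: "f \<in> borel_measurable borel" and xy: "(x, y) \<in> spectral_integral E f"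
  shows "ennreal ((norm y)\<^sup>2) = (\<integral>\<^sup>+ t. ennreal ((f t)\<^sup>2) \<partial>\<mu> x)"
proof -
  have "(\<integral>\<^sup>+ t. ennreal ((f t)\<^sup>2) \<partial>\<mu> x) < \<infinity>"
    using xy unfolding spectral_integral_iff by (rule conjunct1)
  then obtain s where s: "L2_approx x f s"
    "(\<lambda>n. \<integral>\<^sup>+ t. ennreal ((s n t)\<^sup>2) \<partial>\<mu> x) \<longlonglongrightarrow> (\<integral>\<^sup>+ t. ennreal ((f t)\<^sup>2) \<partial>\<mu> x)"
    using L2_approx_exists[OF f] by blast
  have "(\<lambda>n. ennreal ((norm (simple_spectral_integral E (s n) x))\<^sup>2)) \<longlonglongrightarrow> ennreal ((norm y)\<^sup>2)"
    using L2_approx_LIMSEQ[OF f xy s(1)] by (intro tendsto_intros)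
  moreover have "ennreal ((norm (simple_spectral_integral E (s n) x))\<^sup>2) =
      (\<integral>\<^sup>+ t. ennreal ((s n t)\<^sup>2) \<partial>\<mu> x)" for n
    by (rule norm_simple_spectral_integral[OF L2_approx_simple[OF s(1)]])
  ultimately show ?thesis
    using s(2) LIMSEQ_unique by auto
qed

lemma spectral_integral_one: "(x, x) \<in> spectral_integral E (\<lambda>_. 1)"
proof -
  have "L2_approx x (\<lambda>_. 1) (\<lambda>_ _. 1)" by (simp add: L2_approx_def)
  moreover have "(\<lambda>n::nat. simple_spectral_integral E (\<lambda>_. 1) x) \<longlonglongrightarrow> x"
    by (simp add: simple_spectral_integral_def)
  moreover have "(\<integral>\<^sup>+ t. ennreal (1\<^sup>2) \<partial>\<mu> x) < \<infinity>"
    by (simp add: emeasure_\<mu>)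
  ultimately show ?thesis
    unfolding spectral_integral_iff by (intro conjI exI[of _ "\<lambda>_ _. 1"])
qed

text \<open>
  All quantitative facts about powers of the operator come from this comparison: a pointwise
  bound on the relevant part of the spectrum gives both membership in the domain and a norm bound.
\<close>

lemma spectral_integral_dominated:
  assumes f[measurable]: "f \<in> borel_measurable borel" and g[measurable]: "g \<in> borel_measurable borel"
    and xy: "(x, y) \<in> spectral_integral E f"
    and c: "c \<ge> 0" and le: "AE t in \<mu> x. \<bar>g t\<bar> \<le> c * \<bar>f t\<bar>"
  obtains z where "(x, z) \<in> spectral_integral E g" "norm z \<le> c * norm y"
proof -
  have "(\<integral>\<^sup>+ t. ennreal ((g t)\<^sup>2) \<partial>\<mu> x) \<le> (\<integral>\<^sup>+ t. ennreal (c\<^sup>2) * ennreal ((f t)\<^sup>2) \<partial>\<mu> x)"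
  proof (rule nn_integral_mono_AE)
    show "AE t in \<mu> x. ennreal ((g t)\<^sup>2) \<le> ennreal (c\<^sup>2) * ennreal ((f t)\<^sup>2)"
      using le
    proof eventually_elim
      case (elim t)
      then have "\<bar>g t\<bar>\<^sup>2 \<le> (c * \<bar>f t\<bar>)\<^sup>2" by (intro power_mono) auto
      then show ?case by (simp add: power_mult_distrib flip: ennreal_mult)
    qed
  qed
  also have "\<dots> = ennreal (c\<^sup>2) * ennreal ((norm y)\<^sup>2)"
    by (simp add: nn_integral_cmult norm_spectral_integral[OF f xy])
  also have "\<dots> = ennreal ((c * norm y)\<^sup>2)"
    by (simp add: power_mult_distrib ennreal_mult)
  finally have *: "(\<integral>\<^sup>+ t. ennreal ((g t)\<^sup>2) \<partial>\<mu> x) \<le> ennreal ((c * norm y)\<^sup>2)" .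
  then have "(\<integral>\<^sup>+ t. ennreal ((g t)\<^sup>2) \<partial>\<mu> x) < \<infinity>"
    using le_less_trans by fastforce
  then obtain z where z: "(x, z) \<in> spectral_integral E g"
    using spectral_integral_exists[OF g] by blast
  have "(norm z)\<^sup>2 \<le> (c * norm y)\<^sup>2"
    using * norm_spectral_integral[OF g z] by (metis ennreal_le_iff zero_le_power2)
  then have "norm z \<le> c * norm y"
    by (rule power2_le_imp_le) (simp add: c)
  with z that show ?thesis by blast
qed

text \<open>
  Passing from \<open>x\<close> to \<open>E S x\<close> shrinks the scalar measure, so the approximation
  for \<open>x\<close> also serves \<open>E S x\<close>, and \<open>E S\<close> commutes with each simple integral.
\<close>

lemma spectral_integral_E:
  assumes S: "S \<in> sets borel" and f[measurable]: "f \<in> borel_measurable borel"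
    and xy: "(x, y) \<in> spectral_integral E f"
  shows "(E S x, E S y) \<in> spectral_integral E f"
proof -
  obtain s where s: "L2_approx x f s" "(\<lambda>n. simple_spectral_integral E (s n) x) \<longlonglongrightarrow> y"
    using xy unfolding spectral_integral_iff by blast
  have simple: "simple_function borel (s n)" for n by (rule L2_approx_simple[OF s(1)])
  have [measurable]: "s n \<in> borel_measurable borel" for n
    using simple by (rule borel_measurable_simple_function)
  have "(\<lambda>n. \<integral>\<^sup>+ t. ennreal ((s n t - f t)\<^sup>2) \<partial>\<mu> (E S x)) \<longlonglongrightarrow> 0"
  proof (rule tendsto_sandwich[OF _ _ tendsto_const])
    show "(\<lambda>n. \<integral>\<^sup>+ t. ennreal ((s n t - f t)\<^sup>2) \<partial>\<mu> x) \<longlonglongrightarrow> 0"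
      by (rule L2_approx_tendsto[OF s(1)])
  qed (auto intro!: always_eventually nn_integral_\<mu>_E_le S)
  then have "L2_approx (E S x) f s" using simple by (simp add: L2_approx_def)
  moreover have "simple_spectral_integral E (s n) (E S x) = E S (simple_spectral_integral E (s n) x)" for n
  proof -
    have "s n -` {c} \<in> sets borel" for c
      using simple_functionD(2)[OF simple, of n "{c}"] by simp
    then have "E (s n -` {c}) (E S x) = E S (E (s n -` {c}) x)" for c
      using S by (simp add: E_Int Int_commute)
    moreover have "linear (E S)" using bounded_linear_E[OF S] by (rule bounded_linear.linear)
    ultimately show ?thesis
      by (simp add: simple_spectral_integral_def linear_sum linear_scale)
  qed
  moreover have "(\<lambda>n. E S (simple_spectral_integral E (s n) x)) \<longlonglongrightarrow> E S y"
    using bounded_linear.tendsto[OF bounded_linear_E[OF S] s(2)] .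
  moreover have "(\<integral>\<^sup>+ t. ennreal ((f t)\<^sup>2) \<partial>\<mu> (E S x)) < \<infinity>"
    using nn_integral_\<mu>_E_le[OF S, of "\<lambda>t. ennreal ((f t)\<^sup>2)" x]
      xy[unfolded spectral_integral_iff, THEN conjunct1] by (auto intro: le_less_trans)
  ultimately show ?thesis
    unfolding spectral_integral_iff by (intro conjI exI[of _ s]) simp_all
qed

lemma spectral_integral_uminus:
  assumes xy: "(x, y) \<in> spectral_integral E f"
  shows "(- x, - y) \<in> spectral_integral E f"
proof -
  have E: "E S (- x) = - E S x" if "S \<in> sets borel" for S
    using bounded_linear_E[OF that] by (simp add: bounded_linear.linear linear_neg)
  have \<mu>: "\<mu> (- x) = \<mu> x"
    by (rule measure_eqI) (simp_all add: emeasure_\<mu> E)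
  obtain s where s: "L2_approx x f s" "(\<lambda>n. simple_spectral_integral E (s n) x) \<longlonglongrightarrow> y"
    using xy unfolding spectral_integral_iff by blast
  have "simple_spectral_integral E (s n) (- x) = - simple_spectral_integral E (s n) x" for n
  proof -
    have "s n -` {c} \<in> sets borel" for c
      using simple_functionD(2)[OF L2_approx_simple[OF s(1)], of n "{c}"] by simp
    then show ?thesis by (simp add: simple_spectral_integral_def E sum_negf)
  qed
  then have "(\<lambda>n. simple_spectral_integral E (s n) (- x)) \<longlonglongrightarrow> - y"
    using tendsto_minus[OF s(2)] by simp
  moreover have "L2_approx (- x) f s"
    using s(1) unfolding L2_approx_def \<mu> .
  ultimately show ?thesis
    using xy unfolding spectral_integral_iff \<mu> by blast
qed

lemma spectral_integral_cong_AE: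
  assumes eq: "AE t in \<mu> x. f t = g t"
  shows "(x, y) \<in> spectral_integral E f \<longleftrightarrow> (x, y) \<in> spectral_integral E g"
proof -
  have "(\<integral>\<^sup>+ t. ennreal ((f t)\<^sup>2) \<partial>\<mu> x) = (\<integral>\<^sup>+ t. ennreal ((g t)\<^sup>2) \<partial>\<mu> x)"
    using eq by (intro nn_integral_cong_AE) (auto elim: eventually_mono)
  moreover have "(\<integral>\<^sup>+ t. ennreal ((s t - f t)\<^sup>2) \<partial>\<mu> x) = (\<integral>\<^sup>+ t. ennreal ((s t - g t)\<^sup>2) \<partial>\<mu> x)" for s
    using eq by (intro nn_integral_cong_AE) (auto elim: eventually_mono)
  ultimately show ?thesis
    by (simp only: spectral_integral_iff L2_approx_def)
qed

text \<open>
  The quadratic form is read off from simple functions that inherit the sign of the integrand.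
\<close>

lemma spectral_integral_inner_nonpos:
  assumes f[measurable]: "f \<in> borel_measurable borel" and xy: "(x, y) \<in> spectral_integral E f"
    and neg: "AE t in \<mu> x. f t \<le> 0"
  shows "y \<bullet> x \<le> 0"
proof -
  obtain s where s: "L2_approx x f s"
    using xy unfolding spectral_integral_iff by blast
  define u where "u n t = min (s n t) 0" for n t
  have simple: "simple_function borel (u n)" for n
    unfolding u_def by (intro simple_function_compose2[where h = min] L2_approx_simple[OF s]) simp
  have "(\<lambda>n. \<integral>\<^sup>+ t. ennreal ((u n t - f t)\<^sup>2) \<partial>\<mu> x) \<longlonglongrightarrow> 0"
  proof (rule tendsto_sandwich[OF _ _ tendsto_const])
    show "(\<lambda>n. \<integral>\<^sup>+ t. ennreal ((s n t - f t)\<^sup>2) \<partial>\<mu> x) \<longlonglongrightarrow> 0"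
      by (rule L2_approx_tendsto[OF s])
    have "AE t in \<mu> x. ennreal ((u n t - f t)\<^sup>2) \<le> ennreal ((s n t - f t)\<^sup>2)" for n
      using neg
    proof eventually_elim
      case (elim t)
      then have "\<bar>u n t - f t\<bar> \<le> \<bar>s n t - f t\<bar>" by (auto simp: u_def min_def)
      then show ?case by (simp add: abs_le_square_iff ennreal_leI)
    qed
    then show "\<forall>\<^sub>F n in sequentially.
        (\<integral>\<^sup>+ t. ennreal ((u n t - f t)\<^sup>2) \<partial>\<mu> x) \<le> (\<integral>\<^sup>+ t. ennreal ((s n t - f t)\<^sup>2) \<partial>\<mu> x)"
      by (simp add: nn_integral_mono_AE)
  qed auto
  then have "L2_approx x f u" using simple by (simp add: L2_approx_def)
  then have "(\<lambda>n. simple_spectral_integral E (u n) x \<bullet> x) \<longlonglongrightarrow> y \<bullet> x"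
    by (intro tendsto_intros L2_approx_LIMSEQ[OF f xy])
  moreover have "simple_spectral_integral E (u n) x \<bullet> x \<le> 0" for n
  proof -
    have "u n -` {c} \<in> sets borel" for c
      using simple_functionD(2)[OF simple, of n "{c}"] by simp
    then show ?thesis
      unfolding simple_spectral_integral_def inner_sum_left
      by (intro sum_nonpos) (auto simp: E_inner_self u_def mult_nonpos_nonneg)
  qed
  ultimately show ?thesis
    by (intro LIMSEQ_le_const2) auto
qed

end

section \<open>Powers of a strictly positive operator\<close>

locale spectral_op = pvm E
  for E :: "real set \<Rightarrow> 'a::{real_inner, complete_space} \<Rightarrow> 'a" +
  fixes DB :: "'a set" and B :: "'a \<Rightarrow> 'a" and m :: real
  assumes graph: "{(x, B x) | x. x \<in> DB} = spectral_integral E (\<lambda>t. t)"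
    and linear: "linear_op DB B"
    and m: "m > 0" and positive: "strictly_positive_op m DB B"
begin

lemma graph_iff: "(x, y) \<in> spectral_integral E (\<lambda>t. t) \<longleftrightarrow> x \<in> DB \<and> y = B x"
  using graph by blast

lemma powr_measurable: "(\<lambda>t::real. t powr \<tau>) \<in> borel_measurable borel"
  by measurable

text \<open>
  The two conditions of strict positivity empty two parts of the spectrum. On the range of
  \<open>E {- n..0}\<close> the operator is everywhere defined with nonpositive quadratic form; on the range of
  \<open>E {0..r}\<close> with \<open>r < m\<close> it shrinks norms below the lower bound \<open>m\<close>. Both ranges are
  therefore zero.
\<close>

lemma AE_spectrum_gt:
  assumes r: "0 \<le> r" "r < m"
  shows "AE t in \<mu> x. r < t"
proof -
  have bounded: "E {c..d} x \<in> DB \<and> norm (B (E {c..d} x)) \<le> q * norm (E {c..d} x)"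
    if "- q \<le> c" "d \<le> q" "0 \<le> q" for c d q
  proof -
    have "AE t in \<mu> (E {c..d} x). \<bar>t\<bar> \<le> q * \<bar>1\<bar>"
      using that by (intro AE_\<mu>_E) auto
    from spectral_integral_dominated[OF borel_measurable_const measurable_ident_sets[OF refl]
        spectral_integral_one that(3) this]
    obtain y where "(E {c..d} x, y) \<in> spectral_integral E (\<lambda>t. t)"
        "norm y \<le> q * norm (E {c..d} x)" .
    then show ?thesis by (auto simp: graph_iff)
  qed
  have "E {- real n..0} x = 0" for n
  proof (rule ccontr)
    let ?u = "E {- real n..0} x"
    assume "?u \<noteq> 0"
    have "?u \<in> DB" using bounded[of "real n" "- real n" 0] by simp
    then have "(?u, B ?u) \<in> spectral_integral E (\<lambda>t. t)" by (simp add: graph_iff)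
    moreover have "AE t in \<mu> ?u. t \<le> 0" by (intro AE_\<mu>_E) auto
    ultimately have "B ?u \<bullet> ?u \<le> 0"
      by (intro spectral_integral_inner_nonpos[where f = "\<lambda>t. t"]) auto
    then show False
      using positive \<open>?u \<in> DB\<close> \<open>?u \<noteq> 0\<close> by (force simp: strictly_positive_op_def)
  qed
  then have "AE t in \<mu> x. t \<notin> {- real n..0}" for n
    by (intro AE_notin_if_E_eq_0) auto
  then have neg: "AE t in \<mu> x. \<forall>n. t \<notin> {- real n..0}"
    unfolding AE_all_countable by blast
  have "E {0..r} x = 0"
  proof -
    let ?u = "E {0..r} x"
    have "m * norm ?u \<le> r * norm ?u"
      using bounded[of r 0 r] r positive by (force simp: strictly_positive_op_def)
    then show ?thesis using r by (simp add: mult_le_cancel_right)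
  qed
  then have "AE t in \<mu> x. t \<notin> {0..r}"
    by (intro AE_notin_if_E_eq_0) auto
  with neg show ?thesis
  proof eventually_elim
    case (elim t)
    obtain n :: nat where "- t \<le> real n" using real_arch_simple by blast
    then have "- real n \<le> t" by simp
    then show ?case using elim by (cases "t \<le> 0") auto
  qed
qed

lemma powr_1_iff: "(x, y) \<in> spectral_integral E (\<lambda>t. t powr 1) \<longleftrightarrow> x \<in> DB \<and> y = B x"
proof -
  have "AE t in \<mu> x. t powr 1 = t"
    using AE_spectrum_gt[of 0 x] m by (auto elim: eventually_mono)
  from spectral_integral_cong_AE[OF this] show ?thesis by (simp add: graph_iff)
qed

lemma powr_0: "(x, x) \<in> spectral_integral E (\<lambda>t. t powr 0)"
proof -
  have "AE t in \<mu> x. t powr 0 = 1"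
    using AE_spectrum_gt[of 0 x] m by (auto elim: eventually_mono)
  from spectral_integral_cong_AE[OF this] show ?thesis by (simp add: spectral_integral_one)
qed

lemma powr_0_D: "(x, y) \<in> spectral_integral E (\<lambda>t. t powr 0) \<Longrightarrow> y = x"
  using spectral_integral_unique[OF powr_measurable _ powr_0] .

text \<open>Negative powers are bounded because the spectrum stays away from zero.\<close>

lemma negative_powr_total:
  assumes "a \<ge> 0"
  obtains y where "(x, y) \<in> spectral_integral E (\<lambda>t. t powr (- a))"
proof -
  have "AE t in \<mu> x. \<bar>t powr (- a)\<bar> \<le> (m / 2) powr (- a) * \<bar>1\<bar>"
    using AE_spectrum_gt[of "m / 2" x] m
    by (auto elim!: eventually_mono intro!: powr_mono2' simp: assms)
  from spectral_integral_dominated[OF _ powr_measurable spectral_integral_one _ this]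
  show ?thesis using that by auto
qed

text \<open>
  Frequency cutoffs trade regularity for powers of \<open>k\<close>: by commutation with \<open>E S\<close>, only the
  part of the spectrum inside \<open>S\<close> has to satisfy the comparison of the two powers.
\<close>

lemma cutoff_powr:
  assumes S: "S \<in> sets borel" and xy: "(x, y) \<in> spectral_integral E (\<lambda>t. t powr \<tau>)"
    and le: "\<And>t. t \<in> S \<Longrightarrow> 0 < t \<Longrightarrow> t powr (\<sigma> - \<tau>) \<le> c"
    and c: "0 \<le> c"
  obtains z where "(E S x, z) \<in> spectral_integral E (\<lambda>t. t powr \<sigma>)" "norm z \<le> c * norm y"
proof -
  have "AE t in \<mu> x. t \<in> S \<longrightarrow> \<bar>t powr \<sigma>\<bar> \<le> c * \<bar>t powr \<tau>\<bar>"
    using AE_spectrum_gt[of 0 x, OF order_refl m]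
  proof eventually_elim
    case (elim t)
    have "t powr \<sigma> = t powr (\<sigma> - \<tau>) * t powr \<tau>"
      by (simp flip: powr_add)
    then show ?case using elim le by (auto intro!: mult_right_mono)
  qed
  then have "AE t in \<mu> (E S x). \<bar>t powr \<sigma>\<bar> \<le> c * \<bar>t powr \<tau>\<bar>"
    by (rule AE_\<mu>_E[OF S])
  from spectral_integral_dominated[OF powr_measurable powr_measurable
      spectral_integral_E[OF S powr_measurable xy] c this]
  obtain z where z: "(E S x, z) \<in> spectral_integral E (\<lambda>t. t powr \<sigma>)" "norm z \<le> c * norm (E S y)" .
  moreover have "c * norm (E S y) \<le> c * norm y"
    using c norm_E_le[OF S] by (intro mult_left_mono)
  ultimately show ?thesis using that by force
qed

lemma low_cutoff:
  assumes xy: "(x, y) \<in> spectral_integral E (\<lambda>t. t powr \<tau>)" and le: "\<tau> \<le> \<sigma>" and k: "k > 0"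
  obtains z where "(E {..k} x, z) \<in> spectral_integral E (\<lambda>t. t powr \<sigma>)"
    "norm z \<le> k powr (\<sigma> - \<tau>) * norm y"
proof (rule cutoff_powr[OF _ xy])
  show "t powr (\<sigma> - \<tau>) \<le> k powr (\<sigma> - \<tau>)" if "t \<in> {..k}" "0 < t" for t
    using that le k by (intro powr_mono2) auto
qed (use that in auto)

lemma high_cutoff:
  assumes xy: "(x, y) \<in> spectral_integral E (\<lambda>t. t powr \<tau>)" and le: "\<sigma> \<le> \<tau>" and k: "k > 0"
  obtains z where "(E {k<..} x, z) \<in> spectral_integral E (\<lambda>t. t powr \<sigma>)"
    "norm z \<le> k powr (\<sigma> - \<tau>) * norm y"
proof (rule cutoff_powr[OF _ xy])
  show "t powr (\<sigma> - \<tau>) \<le> k powr (\<sigma> - \<tau>)" if "t \<in> {k<..}" "0 < t" for t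
    using that le k by (intro powr_mono2') auto
qed (use that in auto)

lemma norm_low_cutoff_le:
  assumes "(x, y) \<in> spectral_integral E (\<lambda>t. t powr (- a))" "a \<ge> 0" "k > 0"
  shows "norm (E {..k} x) \<le> k powr a * norm y"
proof -
  obtain z where "(E {..k} x, z) \<in> spectral_integral E (\<lambda>t. t powr 0)"
      "norm z \<le> k powr (0 - - a) * norm y"
    using low_cutoff[OF assms(1), of 0 k] assms(2,3) by force
  then show ?thesis using powr_0_D by auto
qed

lemma norm_high_cutoff_le:
  assumes "(x, y) \<in> spectral_integral E (\<lambda>t. t powr p)" "p \<ge> 0" "k > 0"
  shows "norm (E {k<..} x) \<le> k powr (- p) * norm y"
proof -
  obtain z where "(E {k<..} x, z) \<in> spectral_integral E (\<lambda>t. t powr 0)"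
      "norm z \<le> k powr (0 - p) * norm y"
    using high_cutoff[OF assms(1), of 0 k] assms(2,3) by force
  then show ?thesis using powr_0_D by auto
qed

lemma low_cutoff_in_DB:
  assumes "(x, y) \<in> spectral_integral E (\<lambda>t. t powr p)" "p \<le> 1" "k > 0"
  shows "E {..k} x \<in> DB" "norm (B (E {..k} x)) \<le> k powr (1 - p) * norm y"
proof -
  obtain z where "(E {..k} x, z) \<in> spectral_integral E (\<lambda>t. t powr 1)"
      "norm z \<le> k powr (1 - p) * norm y"
    using low_cutoff[OF assms(1), of 1 k] assms(2,3) by blast
  then show "E {..k} x \<in> DB" "norm (B (E {..k} x)) \<le> k powr (1 - p) * norm y"
    unfolding powr_1_iff by auto
qed

lemma low_cutoff_error: "E {..k} x - x = E {k<..} (- x)"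
proof -
  have "x = E {..k} x + E {k<..} x"
    using E_split[of "{..k}" x] by (simp add: Compl_atMost)
  moreover have "E {k<..} (- x) = - E {k<..} x"
    using bounded_linear_E[of "{k<..}"] by (simp add: bounded_linear.linear linear_neg)
  ultimately show ?thesis by (simp add: algebra_simps)
qed

lemma B_diff: "u \<in> DB \<Longrightarrow> v \<in> DB \<Longrightarrow> u - v \<in> DB \<and> B (u - v) = B u - B v"
proof -
  assume u: "u \<in> DB" and v: "v \<in> DB"
  have v': "(- 1) *\<^sub>R v \<in> DB" "B ((- 1) *\<^sub>R v) = (- 1) *\<^sub>R B v"
    using linear v unfolding linear_op_def by (blast intro: subspace_scale)+
  have "u + (- 1) *\<^sub>R v \<in> DB" "B (u + (- 1) *\<^sub>R v) = B u + B ((- 1) *\<^sub>R v)"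
    using linear u v'(1) unfolding linear_op_def by (blast intro: subspace_add)+
  then show ?thesis using v' by simp
qed

text \<open>
  The three pieces of \<open>x - u = E {..k} (x - u) + E {k<..} x - E {k<..} u\<close> are
  controlled by the weak norm of \<open>x - u\<close>, by the strong norm of \<open>x\<close>, and by the
  smoothness of \<open>u\<close>. The element \<open>E {..k} u\<close> serves as competitor: its strong norm
  grows like \<open>k powr (1 - p)\<close>, and the factor \<open>1 / k\<close> gained on high frequencies turns
  this growth into the decay \<open>k powr - p\<close>.
\<close>

lemma error_splitting:
  assumes u: "(u, v) \<in> spectral_integral E (\<lambda>t. t powr p)" and p: "0 < p" "p < 1"
    and a: "0 < a" and k: "1 \<le> k"
    and DB: "x \<in> DB" "xbar \<in> DB"
    and weak: "(x - u, w) \<in> spectral_integral E (\<lambda>t. t powr (- a))" "norm w \<le> \<eta>"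
    and strong: "norm (B (x - xbar)) \<le> norm (B (E {..k} u - xbar))"
  shows "norm (x - u) \<le> k powr a * \<eta> + k powr (- p) * (2 * norm v + 2 * norm (B xbar))"
proof -
  have k0: "k > 0" using k by simp
  have "norm (E {..k} (x - u)) \<le> k powr a * norm w"
    using norm_low_cutoff_le[OF weak(1)] a k0 by simp
  also have "\<dots> \<le> k powr a * \<eta>"
    using weak(2) by (intro mult_left_mono) auto
  finally have low: "norm (E {..k} (x - u)) \<le> k powr a * \<eta>" .
  have tail: "norm (E {k<..} u) \<le> k powr (- p) * norm v"
    using norm_high_cutoff_le[OF u] p k0 by simp
  note xk = low_cutoff_in_DB[OF u less_imp_le[OF p(2)] k0]
  have "norm (B x) \<le> norm (B (x - xbar)) + norm (B xbar)"
    using B_diff[OF DB] norm_triangle_sub[of "B x" "B xbar"] by simp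
  also have "\<dots> \<le> norm (B (E {..k} u)) + norm (B xbar) + norm (B xbar)"
    using strong B_diff[OF xk(1) DB(2)] norm_triangle_ineq4[of "B (E {..k} u)" "B xbar"] by simp
  finally have Bx: "norm (B x) \<le> k powr (1 - p) * norm v + 2 * norm (B xbar)"
    using xk(2) by simp
  have "norm (E {k<..} x) \<le> k powr (- 1) * norm (B x)"
    using norm_high_cutoff_le[of x "B x" 1 k] DB k0 powr_1_iff by simp
  also have "\<dots> \<le> k powr (- 1) * (k powr (1 - p) * norm v + 2 * norm (B xbar))"
    using Bx by (intro mult_left_mono) auto
  also have "\<dots> = k powr (- p) * norm v + k powr (- 1) * (2 * norm (B xbar))"
  proof -
    have "k powr (- 1) * k powr (1 - p) = k powr (- p)"
      by (subst powr_add[symmetric]) simp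
    then show ?thesis by (metis distrib_left mult.assoc)
  qed
  also have "\<dots> \<le> k powr (- p) * norm v + k powr (- p) * (2 * norm (B xbar))"
    using k p by (intro add_left_mono mult_right_mono powr_mono) auto
  finally have high: "norm (E {k<..} x) \<le> k powr (- p) * norm v + k powr (- p) * (2 * norm (B xbar))" .
  have "x - u = E {..k} (x - u) + (E {k<..} x - E {k<..} u)"
    using E_split[of "{..k}" "x - u"] E_diff[of "{k<..}" x u] by (simp add: Compl_atMost)
  then have "norm (x - u) = norm (E {..k} (x - u) + (E {k<..} x - E {k<..} u))"
    by (rule arg_cong)
  also have "\<dots> \<le> norm (E {..k} (x - u)) + norm (E {k<..} x - E {k<..} u)"
    by (rule norm_triangle_ineq)
  also have "\<dots> \<le> norm (E {..k} (x - u)) + (norm (E {k<..} x) + norm (E {k<..} u))"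
    by (intro add_left_mono norm_triangle_ineq4)
  finally have "norm (x - u) \<le> norm (E {..k} (x - u)) + (norm (E {k<..} x) + norm (E {k<..} u))" .
  then show ?thesis
    using low high tail by (simp add: algebra_simps)
qed

end

section \<open>The convergence rate\<close>

theorem mainTheorem1:
  fixes F :: "'x::{real_inner, complete_space} \<Rightarrow> 'y::{real_inner, complete_space}"
    and DF DB :: "'x set" and B :: "'x \<Rightarrow> 'x"
    and xdag xbar :: 'x and y :: 'y
    and m a c\<^sub>a C\<^sub>a p E C :: real
    and yd :: "real \<Rightarrow> 'y" and \<alpha>DP :: "real \<Rightarrow> 'y \<Rightarrow> real" and xd :: "real \<Rightarrow> 'x"
  assumes inf_dim: "infinite_dimensional TYPE('x)" "infinite_dimensional TYPE('y)"
    and B: "self_adjoint_op DB B" "unbounded_op DB B" "m > 0" "strictly_positive_op m DB B"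
    and solution: "xdag \<in> DF" "F xdag = y"
    and reference: "xbar \<in> DF \<inter> DB"
    and A1: "weakly_seq_continuous_on DF F" "convex DF" "closed DF" "xdag \<in> interior DF"
    and A2: "a > 0" "0 < c\<^sub>a" "c\<^sub>a < C\<^sub>a"
      "\<And>x. x \<in> DF \<inter> DB \<Longrightarrow>
         c\<^sub>a * scale_norm DB B (- a) (x - xdag) \<le> norm (F x - F xdag) \<and>
         norm (F x - F xdag) \<le> C\<^sub>a * scale_norm DB B (- a) (x - xdag)"
    and A3: "0 < p" "p < 1" "xdag \<in> op_powr_dom DB B p"
      "norm (op_powr DB B p (xdag - xbar)) \<le> E" "xdag \<notin> DB"
    and C: "C > 1"
    and data: "\<forall>\<^sub>F \<delta> in at_right 0. norm (y - yd \<delta>) \<le> \<delta>"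
    and \<alpha>_pos: "\<forall>\<^sub>F \<delta> in at_right 0. \<alpha>DP \<delta> (yd \<delta>) > 0"
    and minimizer: "\<forall>\<^sub>F \<delta> in at_right 0.
      is_arg_min (tikhonov F B xbar (yd \<delta>) (\<alpha>DP \<delta> (yd \<delta>))) (\<lambda>x. x \<in> DF \<inter> DB) (xd \<delta>)"
    and discrepancy: "\<forall>\<^sub>F \<delta> in at_right 0. norm (F (xd \<delta>) - yd \<delta>) = C * \<delta>"
  shows "(\<lambda>\<delta>. norm (xd \<delta> - xdag)) \<in> O[at_right 0](\<lambda>\<delta>. \<delta> powr (p / (a + p)))"
proof -
  \<comment> \<open>A nonempty domain of a power is possible only if a spectral measure exists.\<close>
  define P where "P = spectral_measure_of DB B"
  have spectral: "is_spectral_measure_of P DB B"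
    using A3(3) by (auto simp: op_powr_dom_def op_powr_graph_def P_def)
  interpret spectral_op P DB B m
    using spectral B by unfold_locales (auto simp: is_spectral_measure_of_def self_adjoint_op_def)
  have graph_powr: "op_powr_graph DB B \<tau> = spectral_integral P (\<lambda>t. t powr \<tau>)" for \<tau>
    using spectral by (auto simp: op_powr_graph_def P_def)
  have scale_norm: "scale_norm DB B \<tau> u = norm v"
    if "(u, v) \<in> spectral_integral P (\<lambda>t. t powr \<tau>)" for \<tau> u v
  proof -
    have "op_powr DB B \<tau> u = v"
      unfolding op_powr_def graph_powr
      using that spectral_integral_unique[OF powr_measurable _ that] by (intro the_equality)
    then show ?thesis by (simp add: scale_norm_def)
  qed
  obtain v where v: "(xdag, v) \<in> spectral_integral P (\<lambda>t. t powr p)"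
    using A3(3) by (auto simp: op_powr_dom_def graph_powr)

  define K where "K = C\<^sub>a * (norm v + 1) / (C - 1)"
  define q where "q = p / (a + p)"
  \<comment> \<open>\<open>K\<close> and \<open>k\<close> solve \<open>C\<^sub>a * k powr (- a - p) * (norm v + 1) = (C - 1) * \<delta>\<close>, so that the
    misfit of \<open>xk \<delta>\<close> stays below \<open>C * \<delta>\<close>; the summand \<open>1\<close> keeps \<open>K\<close> positive when \<open>v = 0\<close>.\<close>
  define k where "k \<delta> = (K / \<delta>) powr (1 / (a + p))" for \<delta>
  define xk where "xk \<delta> = P {..k \<delta>} xdag" for \<delta>
  have Ca: "C\<^sub>a > 0" using A2 by simp
  have K: "K > 0"
    using Ca C by (simp add: K_def add_nonneg_pos)
  have ap: "a + p > 0" and q: "q > 0" using A2(1) A3(1) by (simp_all add: q_def)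
  have k_pos: "k \<delta> > 0" if "\<delta> > 0" for \<delta>
    using that K by (simp add: k_def)
  have k_weak: "k \<delta> powr (- a - p) = \<delta> / K" if "\<delta> > 0" for \<delta>
  proof -
    have "1 / (a + p) * (- a - p) = -1"
      using ap by (simp add: field_simps)
    then have "k \<delta> powr (- a - p) = (K / \<delta>) powr (-1)"
      by (simp only: k_def powr_powr)
    then show ?thesis using that K by (simp add: powr_minus_divide)
  qed
  have k_rate: "k \<delta> powr (- p) = \<delta> powr q / K powr q" if "\<delta> > 0" for \<delta>
  proof -
    have "1 / (a + p) * (- p) = - q" by (simp add: q_def)
    then have "k \<delta> powr (- p) = (K / \<delta>) powr (- q)"
      by (simp only: k_def powr_powr)
    then show ?thesis using that K by (simp add: powr_minus powr_divide)
  qed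

  have pos: "\<forall>\<^sub>F \<delta>::real in at_right 0. 0 < \<delta>"
    by (rule eventually_at_right_less)
  have k_ge_1: "\<forall>\<^sub>F \<delta> in at_right 0. 1 \<le> k \<delta>"
  proof -
    have "\<forall>\<^sub>F \<delta> in at_right 0. \<delta> \<in> {0<..<K}"
      using K by (rule eventually_at_right_real)
    then show ?thesis
      by eventually_elim (use ap in \<open>auto simp: k_def intro!: ge_one_powr_ge_zero\<close>)
  qed
  obtain e where e: "e > 0" "ball xdag e \<subseteq> DF"
    using A1(4) by (auto simp: mem_interior)
  have competitor_in_DF: "\<forall>\<^sub>F \<delta> in at_right 0. xk \<delta> \<in> DF"
  proof -
    have "\<forall>\<^sub>F \<delta>::real in at_right 0. 0 \<le> \<delta>"
      using pos by (rule eventually_mono) simp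
    then have "((\<lambda>\<delta>. \<delta> powr q / K powr q * norm v) \<longlongrightarrow> 0 / K powr q * norm v) (at_right 0)"
      using q K by (intro tendsto_intros tendsto_zero_powrI[where b = q]) auto
    then have "\<forall>\<^sub>F \<delta> in at_right 0. \<delta> powr q / K powr q * norm v < e"
      using e by (intro order_tendstoD) auto
    with pos show ?thesis
    proof eventually_elim
      case (elim \<delta>)
      have "norm (xk \<delta> - xdag) \<le> k \<delta> powr (- p) * norm (- v)"
        using norm_high_cutoff_le[OF spectral_integral_uminus[OF v] _ k_pos[OF elim(1)]] A3(1)
        by (simp add: low_cutoff_error xk_def)
      then have "norm (xk \<delta> - xdag) < e"
        using elim by (simp add: k_rate)
      then show ?case
        using e(2) by (auto simp: dist_norm norm_minus_commute)
    qed
  qed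

  define M where "M = ((C + 1) * K / c\<^sub>a + 2 * norm v + 2 * norm (B xbar)) / K powr q"
  have "\<forall>\<^sub>F \<delta> in at_right 0. norm (xd \<delta> - xdag) \<le> M * \<delta> powr q"
    using pos k_ge_1 competitor_in_DF data \<alpha>_pos minimizer discrepancy
  proof eventually_elim
    case (elim \<delta>)
    note k0 = k_pos[OF elim(1)]
    have xd: "xd \<delta> \<in> DF \<inter> DB"
      using elim(6) by (simp add: is_arg_min_def)
    have xk: "xk \<delta> \<in> DF \<inter> DB"
      using elim(3) low_cutoff_in_DB(1)[OF v _ k0] A3(2) by (simp add: xk_def)
    obtain z where z: "(xk \<delta> - xdag, z) \<in> spectral_integral P (\<lambda>t. t powr (- a))"
        "norm z \<le> k \<delta> powr (- a - p) * norm v"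
      using high_cutoff[OF spectral_integral_uminus[OF v], of "- a" "k \<delta>"] k0 A2(1) A3(1)
      by (auto simp: low_cutoff_error xk_def)
    have "norm (F (xk \<delta>) - y) \<le> C\<^sub>a * norm z"
      using A2(4)[OF xk] by (simp add: scale_norm[OF z(1)] solution)
    also have "\<dots> \<le> C\<^sub>a * (\<delta> / K * (norm v + 1))"
      using z(2) elim(1) K Ca
      by (intro mult_left_mono) (auto simp: k_weak[OF elim(1)] distrib_left intro: order_trans)
    also have "\<dots> = (C - 1) * \<delta>"
      using C Ca by (simp add: K_def field_simps add_nonneg_eq_0_iff)
    finally have "norm (F (xk \<delta>) - yd \<delta>) \<le> C * \<delta>"
      using norm_triangle_ineq[of "F (xk \<delta>) - y" "y - yd \<delta>"] elim(4) by (simp add: algebra_simps)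
    then have "(norm (F (xk \<delta>) - yd \<delta>))\<^sup>2 \<le> (norm (F (xd \<delta>) - yd \<delta>))\<^sup>2"
      unfolding elim(7) by (rule power_mono) simp
    \<comment> \<open>The discrepancy principle fixes the misfit of the minimizer at \<open>C * \<delta>\<close>. Minimality
      therefore compares the penalties alone, and \<open>\<alpha>\<close> cancels.\<close>
    moreover have "tikhonov F B xbar (yd \<delta>) (\<alpha>DP \<delta> (yd \<delta>)) (xd \<delta>) \<le>
        tikhonov F B xbar (yd \<delta>) (\<alpha>DP \<delta> (yd \<delta>)) (xk \<delta>)"
      using elim(6) xk by (auto simp: is_arg_min_def not_less)
    ultimately have "\<alpha>DP \<delta> (yd \<delta>) * (norm (B (xd \<delta> - xbar)))\<^sup>2 \<le>
        \<alpha>DP \<delta> (yd \<delta>) * (norm (B (xk \<delta> - xbar)))\<^sup>2"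
      unfolding tikhonov_def by linarith
    then have strong: "norm (B (xd \<delta> - xbar)) \<le> norm (B (xk \<delta> - xbar))"
      using elim(5) by (simp add: mult_le_cancel_left_pos power_mono_iff)
    obtain w where w: "(xd \<delta> - xdag, w) \<in> spectral_integral P (\<lambda>t. t powr (- a))"
      using negative_powr_total A2(1) by (meson less_imp_le)
    have "c\<^sub>a * norm w \<le> norm (F (xd \<delta>) - y)"
      using A2(4)[OF xd] by (simp add: scale_norm[OF w] solution)
    also have "\<dots> \<le> (C + 1) * \<delta>"
      using norm_triangle_ineq[of "F (xd \<delta>) - yd \<delta>" "yd \<delta> - y"] elim(4,7)
      by (simp add: algebra_simps norm_minus_commute)
    finally have weak: "norm w \<le> (C + 1) * \<delta> / c\<^sub>a"
      using A2(2) by (simp add: field_simps)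
    have "norm (xd \<delta> - xdag) \<le> k \<delta> powr a * ((C + 1) * \<delta> / c\<^sub>a) +
        k \<delta> powr (- p) * (2 * norm v + 2 * norm (B xbar))"
      using xd reference
      by (intro error_splitting[OF v A3(1,2) A2(1) elim(2) _ _ w weak strong[unfolded xk_def]]) auto
    also have "k \<delta> powr a * ((C + 1) * \<delta> / c\<^sub>a) = k \<delta> powr (- p) * ((C + 1) * K / c\<^sub>a)"
    proof -
      have "k \<delta> powr a * (\<delta> / K) = k \<delta> powr (- p)"
        unfolding k_weak[OF elim(1), symmetric] by (subst powr_add[symmetric]) simp
      then have "k \<delta> powr a * \<delta> = k \<delta> powr (- p) * K"
        using K by (simp add: field_simps)
      then show ?thesis by (simp add: field_simps)
    qed
    finally have "norm (xd \<delta> - xdag) \<le>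
        k \<delta> powr (- p) * ((C + 1) * K / c\<^sub>a + 2 * norm v + 2 * norm (B xbar))"
      by (simp add: distrib_left)
    then show ?case
      by (simp add: k_rate[OF elim(1)] M_def mult.commute)
  qed
  then show ?thesis
    by (intro bigoI[where c = M]) (simp add: q_def)
qed

end
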